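(* Let $n,m,N$ be positive integers with $n>m$ and $\frac{n-1}{n-m}\leq N\leq m$. Then for almost all $\lambda_0\in\mathbb{C}^n$, almost all $X_0\in\mathbb{C}^{m\times N}$ and almost all $A\in\mathbb{C}^{n\times m}$ (i.e., for all $(\lambda_0,X_0,A)\in\mathbb{C}^n\times\mathbb{C}^{m\times N}\times\mathbb{C}^{n\times m}$ outside a set of Lebesgue measure zero), the pair $(\lambda_0,X_0)$ is identifiable up to scaling in the BGPC problem with a subspace constraint: whenever $\lambda\in\mathbb{C}^n$ and $X\in\mathbb{C}^{m\times N}$ satisfy $\operatorname{diag}(\lambda)AX=\operatorname{diag}(\lambda_0)AX_0$, there exists a nonzero $\sigma\in\mathbb{C}$ with $\lambda=\sigma\lambda_0$ and $X=\frac{1}{\sigma}X_0$.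
   Context: $\operatorname{diag}(\lambda)$ denotes the $n\times n$ diagonal matrix with the entries of $\lambda$ on its diagonal. The BGPC (blind gain and phase calibration) problem with a subspace constraint is: given $A$ and $Y=\operatorname{diag}(\lambda_0)AX_0$, find $(\lambda,X)\in\mathbb{C}^n\times\mathbb{C}^{m\times N}$ with $\operatorname{diag}(\lambda)AX=Y$. Lebesgue measure on complex spaces is taken via the identification $\mathbb{C}\cong\mathbb{R}^2$. *)

theory Defs
  imports "HOL-Analysis.Analysis"
begin

definition diag_mat :: "complex ^ 'n \<Rightarrow> complex ^ 'n ^ 'n" where
  "diag_mat l = (\<chi> i j. if i = j then l $ i else 0)"

end

theory Submission
  imports Defs
begin

text \<open>If no entry of \<open>l0\<close> vanishes and \<open>A X0\<close> has no zero row, a second solution \<open>(l, X)\<close> amounts to a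
  solution of \<open>A X = diag(h) A X0\<close> with \<open>h = l0 / l\<close>. This system is linear in \<open>(h, X)\<close> and has the
  trivial solutions \<open>(c, c X0)\<close>; once there are no others, identifiability follows. That the
  solution space is a line holds wherever a certain minor, a polynomial in \<open>(X0, A)\<close>, is nonzero, so one
  instance \<open>(X1, A1)\<close> suffices. It is built from characters of \<open>\<int>/n\<close>.\<close>

section \<open>Zero sets of polynomial functions\<close>

lemma finite_zeros_real_polynomial_function:
  fixes g :: "real \<Rightarrow> real"
  assumes "real_polynomial_function g" "g s \<noteq> 0"
  shows "finite {t. g t = 0}"
proof -
  obtain a n where g: "g = (\<lambda>x. \<Sum>i\<le>n. a i * x^i)"
    using assms(1) by (auto simp: real_polynomial_function_iff_sum)
  then obtain k where "k \<le> n" "a k \<noteq> 0"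
    using assms(2) by (metis (no_types, lifting) atMost_iff mult_zero_left sum.neutral)
  then show ?thesis
    using polyfun_roots_finite[of a k n] by (simp add: g)
qed

text \<open>On every line through \<open>a\<close> the zeros are finite, so by Fubini the map \<open>x \<mapsto> f (a + t x)\<close> is
  nonzero almost everywhere for some \<open>t \<noteq> 0\<close>, and \<open>x \<mapsto> a + t x\<close> preserves null sets.\<close>

lemma AE_nonzero_real_polynomial_function:
  fixes f :: "'a::euclidean_space \<Rightarrow> real"
  assumes f: "real_polynomial_function f" and a: "f a \<noteq> 0"
  shows "AE x in lebesgue. f x \<noteq> 0"
proof -
  have cont: "continuous_on UNIV f"
    using continuous_on_polymonial_function f real_polynomial_function_eq by blast
  then have meas[measurable]: "f \<in> borel_measurable borel"
    by (rule borel_measurable_continuous_onI)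
  have line: "AE t in lborel. f (a + t *\<^sub>R x) \<noteq> 0" for x
  proof -
    have "polynomial_function (\<lambda>t::real. a + t *\<^sub>R x)"
      by (intro polynomial_function_add polynomial_function_mult) auto
    then have "real_polynomial_function (\<lambda>t. f (a + t *\<^sub>R x))"
      using real_polynomial_function_compose[OF _ f] by (simp add: o_def)
    then have "finite {t. f (a + t *\<^sub>R x) = 0}"
      using a by (intro finite_zeros_real_polynomial_function[where s = 0]) auto
    then have "{t. f (a + t *\<^sub>R x) = 0} \<in> null_sets lborel"
      by (rule finite_imp_null_set_lborel)
    from AE_not_in[OF this] show ?thesis
      by simp
  qed
  have "(AE x in lborel. AE t in lborel. f (a + t *\<^sub>R x) \<noteq> 0) \<longleftrightarrow>
        (AE t in lborel. AE x in lborel. f (a + t *\<^sub>R x) \<noteq> 0)"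
    by (rule lborel_pair.AE_commute) measurable
  with line have "AE t in lborel. AE x in lborel. f (a + t *\<^sub>R x) \<noteq> 0"
    by simp
  moreover have "AE t in lborel. t \<noteq> (0::real)"
    by (rule AE_lborel_singleton)
  ultimately have "AE t in lborel. t \<noteq> (0::real) \<and> (AE x in lborel. f (a + t *\<^sub>R x) \<noteq> 0)"
    by eventually_elim simp
  \<comment> \<open>The whole line is not a null set, so a property that holds almost everywhere has
    a witness.\<close>
  moreover have "ae_filter (lborel :: real measure) \<noteq> bot"
    using AE_iff_measurable[of UNIV "lborel :: real measure" "\<lambda>_. False"]
    by (simp add: trivial_limit_def)
  ultimately obtain t :: real where t: "t \<noteq> 0" "AE x in lborel. f (a + t *\<^sub>R x) \<noteq> 0"
    using eventually_happens' by blast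
  have "AE x in lborel. f x \<noteq> 0"
    using t by (subst lborel_affine[of t a]) (simp_all add: AE_density AE_distr_iff)
  then show ?thesis
    by (rule AE_completion)
qed

lemma polynomial_function_complex_iff:
  fixes f :: "'a::real_normed_vector \<Rightarrow> complex"
  shows "polynomial_function f \<longleftrightarrow>
    real_polynomial_function (\<lambda>x. Re (f x)) \<and> real_polynomial_function (\<lambda>x. Im (f x))"
  by (simp add: polynomial_function_iff_Basis_inner Basis_complex_def)

lemma polynomial_function_complex_mult:
  fixes f g :: "'a::real_normed_vector \<Rightarrow> complex"
  assumes "polynomial_function f" "polynomial_function g"
  shows "polynomial_function (\<lambda>x. f x * g x)"
  using assms unfolding polynomial_function_complex_iff
  by (auto intro!: real_polynomial_function_diff real_polynomial_function.intros(3,4))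

lemma polynomial_function_complex_prod:
  fixes f :: "'a::real_normed_vector \<Rightarrow> 'i \<Rightarrow> complex"
  assumes "finite I" "\<And>i. i \<in> I \<Longrightarrow> polynomial_function (\<lambda>x. f x i)"
  shows "polynomial_function (\<lambda>x. \<Prod>i\<in>I. f x i)"
  using assms by (induction I rule: finite_induct) (auto intro: polynomial_function_complex_mult)

lemma polynomial_function_det:
  fixes M :: "'a::real_normed_vector \<Rightarrow> complex ^ 'k ^ 'k"
  assumes "\<And>i j. polynomial_function (\<lambda>x. M x $ i $ j)"
  shows "polynomial_function (\<lambda>x. det (M x))"
  unfolding det_def
  by (intro polynomial_function_sum polynomial_function_complex_mult
      polynomial_function_complex_prod assms polynomial_function_const)
     (auto simp: finite_permutations)

lemma AE_nonzero_complex_polynomial_function: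
  fixes f :: "'a::euclidean_space \<Rightarrow> complex"
  assumes f: "polynomial_function f" and a: "f a \<noteq> 0"
  shows "AE x in lebesgue. f x \<noteq> 0"
proof -
  \<comment> \<open>The squared modulus is a real polynomial with the same zeros as
    \<open>f\<close>.\<close>
  let ?g = "\<lambda>x. (Re (f x))\<^sup>2 + (Im (f x))\<^sup>2"
  have "real_polynomial_function ?g"
    using f unfolding polynomial_function_complex_iff
    by (intro real_polynomial_function.intros(3) real_polynomial_function_power) auto
  moreover have "?g x = 0 \<longleftrightarrow> f x = 0" for x
    by (simp add: complex_eq_iff sum_power2_eq_zero_iff)
  ultimately show ?thesis
    using AE_nonzero_real_polynomial_function[of ?g a] a by simp
qed

section \<open>The calibration equations as a linear system\<close>

text \<open>Unlike a quotient \<open>l0 / l\<close>, \<open>h\<close> may have zero entries, and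
  \<open>c\<close> may be zero. The condition is thus purely linear: the solution space is exactly
  the line spanned by \<open>(1, X0)\<close>.\<close>

definition rigid :: "complex ^ 'm ^ 'n \<Rightarrow> complex ^ 'N ^ 'm \<Rightarrow> bool" where
  "rigid A X0 \<longleftrightarrow> (\<forall>h X. (\<forall>i q. (A ** X) $ i $ q = h $ i * (A ** X0) $ i $ q) \<longrightarrow>
     (\<exists>c. (\<forall>i. h $ i = c) \<and> (\<forall>p q. X $ p $ q = c * X0 $ p $ q)))"

lemma rigidE:
  assumes "rigid A X0" "\<And>i q. (A ** X) $ i $ q = h $ i * (A ** X0) $ i $ q"
  obtains c where "\<And>i. h $ i = c" "\<And>p q. X $ p $ q = c * X0 $ p $ q"
  using assms unfolding rigid_def by metis

lemma diag_mat_mult_nth: "(diag_mat l ** A ** X) $ i $ q = l $ i * (A ** X) $ i $ q"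
proof -
  have "(diag_mat l ** M) $ i $ q = l $ i * M $ i $ q" for M
    by (simp add: diag_mat_def matrix_matrix_mult_def if_distrib[of "\<lambda>x. x * _"] cong: if_cong)
  then show ?thesis
    by (simp flip: matrix_mul_assoc)
qed

text \<open>Rigidity with more than one row excludes zero rows of \<open>A ** X0\<close>, hence zero
  entries of \<open>l\<close>. Then \<open>h = l0 / l\<close> is a constant \<open>c\<close>, and
  \<open>\<sigma> = 1 / c\<close>.\<close>

lemma rigid_imp_identifiable:
  fixes A :: "complex ^ 'm ^ 'n" and X0 :: "complex ^ 'N ^ 'm"
  assumes rigid: "rigid A X0" and l0: "\<And>i. l0 $ i \<noteq> 0" and n: "1 < CARD('n)"
    and eq: "diag_mat l ** A ** X = diag_mat l0 ** A ** X0"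
  shows "\<exists>\<sigma>::complex. \<sigma> \<noteq> 0 \<and> l = \<sigma> *s l0 \<and> X = (\<chi> i j. X0 $ i $ j / \<sigma>)"
proof -
  have eq': "l $ i * (A ** X) $ i $ q = l0 $ i * (A ** X0) $ i $ q" for i q
    using eq by (metis diag_mat_mult_nth)
  have l: "l $ i \<noteq> 0" for i
  proof
    assume "l $ i = 0"
    then have row: "(A ** X0) $ i $ q = 0" for q
      using eq'[of i q] l0[of i] by simp
    \<comment> \<open>a zero row of \<^term>\<open>A ** X0\<close> would leave the gain of that row undetermined\<close>
    have "(A ** 0) $ j $ q = (axis i 1 :: complex ^ 'n) $ j * (A ** X0) $ j $ q" for j q
      using row by (simp add: axis_def matrix_matrix_mult_def)
    then obtain c where c: "\<And>j. (axis i 1 :: complex ^ 'n) $ j = c"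
      by (rule rigidE[OF rigid]) (rule that)
    have "(UNIV :: 'n set) \<noteq> {i}"
      using n by (metis One_nat_def card_1_singleton_iff less_irrefl)
    then obtain j where "j \<noteq> i"
      by auto
    then show False
      using c[of i] c[of j] by (simp add: axis_def)
  qed
  have "(A ** X) $ i $ q = (\<chi> i. l0 $ i / l $ i) $ i * (A ** X0) $ i $ q" for i q
    using eq'[of i q] l[of i] by (simp add: field_simps)
  then obtain c where "\<And>i. (\<chi> i. l0 $ i / l $ i) $ i = c" and X: "\<And>p q. X $ p $ q = c * X0 $ p $ q"
    by (rule rigidE[OF rigid]) (rule that)
  then have c: "l0 $ i / l $ i = c" for i
    by simp
  then have "c \<noteq> 0"
    using l0 l by (metis divide_eq_0_iff)
  moreover have "l = (1 / c) *s l0"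
    unfolding vec_eq_iff
  proof
    fix i
    show "l $ i = ((1 / c) *s l0) $ i"
      using c[of i] l[of i] \<open>c \<noteq> 0\<close> by (simp add: field_simps)
  qed
  ultimately show ?thesis
    using X by (intro exI[of _ "1 / c"]) (simp add: vec_eq_iff mult.commute)
qed

text \<open>The matrix of \<^term>\<open>\<lambda>(h, X). (A ** X - diag_mat h ** A ** X0, h $ i0)\<close>; the last coordinate,
  in row \<^term>\<open>None\<close>, removes the scaling direction \<open>(1, X0)\<close> from the kernel.\<close>

definition cal_mat ::
  "'n::finite \<Rightarrow> complex ^ 'm ^ 'n \<Rightarrow> complex ^ 'N ^ 'm \<Rightarrow> complex ^ ('n + 'm \<times> 'N) ^ (('n \<times> 'N) option)"
where
  "cal_mat i0 A X0 = (\<chi> r c. case r of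
      None \<Rightarrow> if c = Inl i0 then 1 else 0
    | Some (i, q) \<Rightarrow> (case c of
        Inl i' \<Rightarrow> if i' = i then - (A ** X0) $ i $ q else 0
      | Inr (p, q') \<Rightarrow> if q' = q then A $ i $ p else 0))"

lemma sum_UNIV_Plus:
  fixes f :: "'a::finite + 'b::finite \<Rightarrow> 'c::comm_monoid_add"
  shows "sum f UNIV = (\<Sum>a\<in>UNIV. f (Inl a)) + (\<Sum>b\<in>UNIV. f (Inr b))"
  by (simp add: sum.Plus flip: UNIV_Plus_UNIV)

lemma cal_mat_mult_None: "(cal_mat i0 A X0 *v z) $ None = z $ Inl i0"
  by (simp add: cal_mat_def matrix_vector_mult_def if_distrib[of "\<lambda>x. x * _"] cong: if_cong)

lemma cal_mat_mult_Some:
  "(cal_mat i0 A X0 *v z) $ Some (i, q) =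
    (A ** (\<chi> p q. z $ Inr (p, q))) $ i $ q - z $ Inl i * (A ** X0) $ i $ q"
proof -
  have "(\<Sum>b\<in>UNIV. cal_mat i0 A X0 $ Some (i, q) $ Inr b * z $ Inr b) =
      (\<Sum>p\<in>UNIV. \<Sum>q'\<in>UNIV. (if q' = q then A $ i $ p else 0) * z $ Inr (p, q'))"
    by (auto simp: cal_mat_def sum.cartesian_product intro!: sum.cong)
  also have "\<dots> = (A ** (\<chi> p q. z $ Inr (p, q))) $ i $ q"
    by (simp add: matrix_matrix_mult_def if_distrib[of "\<lambda>x. x * _"] cong: if_cong)
  finally show ?thesis
    by (simp add: matrix_vector_mult_def sum_UNIV_Plus)
       (simp add: cal_mat_def if_distrib[of "\<lambda>x. x * _"] cong: if_cong)
qed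

lemma matrix_mult_diff_scaled_nth:
  fixes A :: "complex ^ 'm ^ 'n"
  shows "(A ** (\<chi> p q. X $ p $ q - c * X0 $ p $ q)) $ i $ q = (A ** X) $ i $ q - c * (A ** X0) $ i $ q"
  by (simp add: matrix_matrix_mult_def algebra_simps sum_subtractf sum_distrib_left)

text \<open>The trivial solution \<open>(1, X0)\<close> has coordinate 1 at \<open>i0\<close>, so it
  spans all solutions iff no nonzero solution vanishes at \<open>i0\<close>. Any row can serve as
  \<open>i0\<close>.\<close>

lemma rigid_iff_cal_mat:
  fixes A :: "complex ^ 'm ^ 'n" and X0 :: "complex ^ 'N ^ 'm"
  shows "rigid A X0 \<longleftrightarrow> (\<forall>z. cal_mat i0 A X0 *v z = 0 \<longrightarrow> z = 0)"
proof
  assume rigid: "rigid A X0"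
  show "\<forall>z. cal_mat i0 A X0 *v z = 0 \<longrightarrow> z = 0"
  proof (intro allI impI)
    fix z assume z: "cal_mat i0 A X0 *v z = 0"
    then have "(A ** (\<chi> p q. z $ Inr (p, q))) $ i $ q = (\<chi> i. z $ Inl i) $ i * (A ** X0) $ i $ q" for i q
      using cal_mat_mult_Some[of i0 A X0 z i q] by simp
    then obtain c where c: "\<And>i. (\<chi> i. z $ Inl i) $ i = c"
        "\<And>p q. (\<chi> p q. z $ Inr (p, q)) $ p $ q = c * X0 $ p $ q"
      by (rule rigidE[OF rigid]) (rule that)
    have "c = 0"
      using z c(1)[of i0] cal_mat_mult_None[of i0 A X0 z] by simp
    with c have "z $ Inl i = 0" "z $ Inr (p, q) = 0" for i p q
      by simp_all
    then have "z $ s = 0" for s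
      by (cases s) auto
    then show "z = 0"
      by (simp add: vec_eq_iff)
  qed
next
  assume ker: "\<forall>z. cal_mat i0 A X0 *v z = 0 \<longrightarrow> z = 0"
  show "rigid A X0"
    unfolding rigid_def
  proof (intro allI impI)
    fix h :: "complex ^ 'n" and X :: "complex ^ 'N ^ 'm"
    assume eq: "\<forall>i q. (A ** X) $ i $ q = h $ i * (A ** X0) $ i $ q"
    \<comment> \<open>Subtracting \<open>h $ i0\<close> times the trivial solution
      \<open>(1, X0)\<close> makes the coordinate at \<open>i0\<close> vanish.\<close>
    define z :: "complex ^ ('n + 'm \<times> 'N)" where
      "z = (\<chi> s. case s of Inl i \<Rightarrow> h $ i - h $ i0 | Inr (p, q) \<Rightarrow> X $ p $ q - h $ i0 * X0 $ p $ q)"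
    have "(cal_mat i0 A X0 *v z) $ r = 0" for r
    proof (cases r)
      case None
      then show ?thesis
        by (simp add: cal_mat_mult_None z_def)
    next
      case (Some iq)
      then show ?thesis
        by (cases iq) (simp add: cal_mat_mult_Some z_def matrix_mult_diff_scaled_nth eq algebra_simps)
    qed
    then have "z = 0"
      using ker by (simp add: vec_eq_iff)
    then have "z $ Inl i = 0" "z $ Inr (p, q) = 0" for i p q
      by simp_all
    then show "\<exists>c. (\<forall>i. h $ i = c) \<and> (\<forall>p q. X $ p $ q = c * X0 $ p $ q)"
      by (intro exI[of _ "h $ i0"]) (simp add: z_def)
  qed
qed

text \<open>\<open>cal_mat\<close> need not be square, so instead of selecting a minor one fixes a
  left inverse \<open>B\<close> at the instance. The polynomial
  \<open>det (B ** cal_mat i0 A X0)\<close> is 1 at \<open>(X1, A1)\<close>, and wherever it is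
  nonzero \<open>cal_mat i0 A X0\<close> has a left inverse.\<close>

lemma AE_rigid:
  fixes A1 :: "complex ^ 'm ^ 'n" and X1 :: "complex ^ 'N ^ 'm"
  assumes "rigid A1 X1"
  shows "AE (l0 :: complex ^ 'n, X0 :: complex ^ 'N ^ 'm, A :: complex ^ 'm ^ 'n) in lebesgue. rigid A X0"
proof -
  define i0 :: 'n where "i0 = undefined"
  obtain B where B: "B ** cal_mat i0 A1 X1 = mat 1"
    using assms unfolding rigid_iff_cal_mat[of _ _ i0] matrix_left_invertible_ker[symmetric] by blast
  let ?f = "\<lambda>(l0 :: complex ^ 'n, X0 :: complex ^ 'N ^ 'm, A :: complex ^ 'm ^ 'n).
    det (B ** cal_mat i0 A X0)"
  have A: "polynomial_function
      (\<lambda>x :: (complex ^ 'n) \<times> (complex ^ 'N ^ 'm) \<times> (complex ^ 'm ^ 'n). snd (snd x) $ i $ p)" for i p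
    by (intro polynomial_function_bounded_linear bounded_linear_compose[OF bounded_linear_vec_nth]
        bounded_linear_fst_comp bounded_linear_snd_comp bounded_linear_fst bounded_linear_snd bounded_linear_ident)
  have X: "polynomial_function
      (\<lambda>x :: (complex ^ 'n) \<times> (complex ^ 'N ^ 'm) \<times> (complex ^ 'm ^ 'n). fst (snd x) $ p $ q)" for p q
    by (intro polynomial_function_bounded_linear bounded_linear_compose[OF bounded_linear_vec_nth]
        bounded_linear_fst_comp bounded_linear_snd_comp bounded_linear_fst bounded_linear_snd bounded_linear_ident)
  have poly_if: "polynomial_function (\<lambda>x. if b then f x else 0)" if "polynomial_function f"
    for b and f :: "(complex ^ 'n) \<times> (complex ^ 'N ^ 'm) \<times> (complex ^ 'm ^ 'n) \<Rightarrow> complex"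
    using that by (cases b) simp_all
  have "polynomial_function (\<lambda>x :: (complex ^ 'n) \<times> (complex ^ 'N ^ 'm) \<times> (complex ^ 'm ^ 'n).
      cal_mat i0 (snd (snd x)) (fst (snd x)) $ r $ c)" for r c
    unfolding cal_mat_def matrix_matrix_mult_def
    by (cases r; cases c)
       (auto split: prod.splits intro!: poly_if polynomial_function_minus polynomial_function_sum
         polynomial_function_complex_mult A X)
  then have "polynomial_function ?f"
    unfolding split_beta
    by (intro polynomial_function_det)
       (auto simp: matrix_matrix_mult_def intro!: polynomial_function_sum polynomial_function_complex_mult)
  moreover have "?f (0, X1, A1) \<noteq> 0"
    by (simp add: B)
  ultimately have "AE x in lebesgue. ?f x \<noteq> 0"
    by (rule AE_nonzero_complex_polynomial_function)
  then show ?thesis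
  proof (rule AE_mp, intro AE_I2 impI)
    fix x assume "?f x \<noteq> 0"
    then have inv: "invertible (B ** cal_mat i0 (snd (snd x)) (fst (snd x)))"
      by (simp add: invertible_det_nz split_beta)
    then obtain C where "C ** (B ** cal_mat i0 (snd (snd x)) (fst (snd x))) = mat 1"
      unfolding invertible_def by blast
    then have "rigid (snd (snd x)) (fst (snd x))"
      unfolding rigid_iff_cal_mat[of _ _ i0] matrix_left_invertible_ker[symmetric]
      by (metis matrix_mul_assoc)
    then show "case x of (l0, X0, A) \<Rightarrow> rigid A X0"
      by (simp add: split_beta)
  qed
qed

section \<open>A rigid instance\<close>

text \<open>Injectivity of the powers below \<open>n\<close> says that \<open>w\<close> has order
  exactly \<open>n\<close>; this is what separates the characters.\<close>

lemma primitive_root_of_unity: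
  assumes "n > 0"
  obtains w :: complex where "w ^ n = 1" "inj_on ((^) w) {..<n}"
proof
  let ?w = "exp (2 * of_real pi * \<i> * of_nat 1 / of_nat n)"
  show "?w ^ n = 1"
    using assms by (intro complex_root_unity) simp
  have pow: "?w ^ k = exp (2 * of_real pi * \<i> * of_nat k / of_nat n)" for k
    by (simp add: mult.commute flip: exp_of_nat_mult)
  show "inj_on ((^) ?w) {..<n}"
    unfolding inj_on_def pow using assms by (auto simp: complex_root_unity_eq)
qed

text \<open>For distinct exponents this is a geometric sum whose ratio is an \<open>n\<close>-th
  root of unity other than 1.\<close>

lemma root_of_unity_orthogonality:
  fixes w :: complex
  assumes w: "w ^ n = 1" "inj_on ((^) w) {..<n}" and "a < n" "b < n"
  shows "(\<Sum>i<n. w ^ (i * a) / w ^ (i * b)) = (if a = b then of_nat n else 0)"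
proof -
  have [simp]: "w \<noteq> 0"
    using w(1) \<open>a < n\<close> by (auto simp: power_0_left)
  have eq: "w ^ (i * a) / w ^ (i * b) = (w ^ a / w ^ b) ^ i" for i
    by (simp add: power_divide mult.commute flip: power_mult)
  show ?thesis
  proof (cases "a = b")
    case False
    then have "w ^ a / w ^ b \<noteq> 1"
      using w(2) \<open>a < n\<close> \<open>b < n\<close> by (auto simp: inj_on_def)
    moreover have "(w ^ a / w ^ b) ^ n = 1"
      using w(1) by (simp add: power_divide flip: power_mult) (simp add: mult.commute[of _ n] power_mult)
    ultimately show ?thesis
      using False by (simp add: eq geometric_sum)
  qed simp
qed

text \<open>Fourier inversion on the cyclic group of order \<open>n\<close>: only frequency 0, the
  mean, survives.\<close>

lemma constant_if_Fourier_coefficients_zero: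
  fixes w :: complex and H :: "nat \<Rightarrow> complex"
  assumes w: "w ^ n = 1" "inj_on ((^) w) {..<n}"
    and zero: "\<And>t. 0 < t \<Longrightarrow> t < n \<Longrightarrow> (\<Sum>i<n. H i / w ^ (i * t)) = 0"
    and "j < n"
  shows "H j = (\<Sum>i<n. H i) / of_nat n"
proof -
  \<comment> \<open>The vanishing coefficients are added back so that the full inversion sum at
    \<open>j\<close> appears.\<close>
  have "(\<Sum>i<n. H i) = (\<Sum>t<n. if t = 0 then (\<Sum>i<n. H i) else 0)"
    using \<open>j < n\<close> by simp
  also have "\<dots> = (\<Sum>t<n. w ^ (t * j) * (\<Sum>i<n. H i / w ^ (i * t)))"
    by (intro sum.cong) (auto simp: zero)
  also have "\<dots> = (\<Sum>t<n. \<Sum>i<n. H i * (w ^ (t * j) / w ^ (t * i)))"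
    by (simp add: sum_distrib_left mult_ac)
  also have "\<dots> = (\<Sum>i<n. H i * (\<Sum>t<n. w ^ (t * j) / w ^ (t * i)))"
    by (subst sum.swap) (simp add: sum_distrib_left)
  also have "\<dots> = (\<Sum>i<n. if i = j then H i * of_nat n else 0)"
    by (intro sum.cong) (auto simp: root_of_unity_orthogonality[OF w \<open>j < n\<close>])
  finally show ?thesis
    using \<open>j < n\<close> by simp
qed

text \<open>The multiples of \<open>N\<close>, capped at \<open>n - 1\<close>, meet every window of
  length \<open>N\<close>; the counting hypothesis says that \<open>n - m\<close> of them reach the
  end. Keeping \<open>C\<close> above the exponents below \<open>N\<close> leaves those free to be
  columns of the instance.\<close>

lemma exists_window_hitting_set:
  fixes n m N :: nat
  assumes "m < n" "N \<le> m" "0 < N" "n - 1 \<le> N * (n - m)"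
  obtains C where "C \<subseteq> {N..<n}" "card C = n - m" "\<And>t. 0 < t \<Longrightarrow> t < n \<Longrightarrow> \<exists>e<N. t + e \<in> C"
proof -
  define C0 where "C0 = (\<lambda>j. min (Suc j * N) (n - 1)) ` {..<n - m}"
  have "card C0 \<le> n - m"
    unfolding C0_def by (metis card_image_le card_lessThan finite_lessThan)
  moreover have "n - m \<le> card {N..<n}"
    using assms by simp
  moreover have sub: "C0 \<subseteq> {N..<n}"
    using assms by (auto simp: C0_def)
  \<comment> \<open>The cap can make elements coincide, so \<open>C0\<close> is padded to exactly
    \<open>n - m\<close> elements; \<open>N \<le> m\<close> leaves enough room.\<close>
  ultimately obtain C where C: "C0 \<subseteq> C" "C \<subseteq> {N..<n}" "card C = n - m"
    by (metis exists_subset_between finite_atLeastLessThan)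
  have "\<exists>e<N. t + e \<in> C" if t: "0 < t" "t < n" for t
  proof -
    \<comment> \<open>\<open>Suc j * N\<close> is the least multiple of \<open>N\<close> that is at
      least \<open>t\<close>; the shift to \<open>t - 1\<close> handles the case that
      \<open>t\<close> is itself a multiple.\<close>
    define j where "j = (t - 1) div N"
    define c where "c = min (Suc j * N) (n - 1)"
    have "t - 1 < N * (n - m)"
      using t assms by linarith
    then have "j < n - m"
      unfolding j_def using assms(3) by (simp add: less_mult_imp_div_less mult.commute)
    then have "c \<in> C"
      using C(1) by (auto simp: c_def C0_def)
    have "t - 1 = j * N + (t - 1) mod N" "(t - 1) mod N < N"
      using assms(3) by (simp_all add: j_def)
    then have "t \<le> c" "c < t + N"
      using t by (auto simp: c_def min_def)
    then show ?thesis
      using \<open>c \<in> C\<close> by (intro exI[of _ "c - t"]) auto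
  qed
  with C that show ?thesis
    by blast
qed

text \<open>\<open>S\<close> must be finite: an infinite set has cardinality 0, whereas a type is
  nonempty.\<close>

lemma exists_bij_betw_UNIV:
  assumes "card S = CARD('a::finite)"
  obtains f :: "'a::finite \<Rightarrow> 'b" where "bij_betw f UNIV S"
  using assms finite_same_card_bij[of "UNIV :: 'a set" S]
  by (metis card.infinite finite_UNIV zero_less_card_finite less_irrefl)

text \<open>The columns of \<open>A1\<close> are the characters of \<open>\<int>/n\<close> with exponent outside \<open>C\<close>, those of
  \<open>A1 ** X1\<close> the first \<open>N\<close> of them. Testing column \<open>e\<close> of \<open>A1 ** X = diag_mat h ** A1 ** X1\<close> against the
  character \<open>t + e \<in> C\<close> kills the Fourier coefficient of \<open>h\<close> at \<open>t\<close>.\<close>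

lemma exists_rigid:
  assumes nm: "CARD('n::finite) > CARD('m::finite)" and Nm: "CARD('N::finite) \<le> CARD('m)"
    and count: "CARD('n) - 1 \<le> CARD('N) * (CARD('n) - CARD('m))"
  shows "\<exists>(A1 :: complex ^ 'm ^ 'n) (X1 :: complex ^ 'N ^ 'm). rigid A1 X1"
proof -
  let ?n = "CARD('n)"
  obtain w :: complex where w: "w ^ ?n = 1" "inj_on ((^) w) {..<?n}"
    using primitive_root_of_unity[of ?n] by auto
  have [simp]: "w \<noteq> 0"
    using w(1) by (auto simp: power_0_left)
  obtain C where C: "C \<subseteq> {CARD('N)..<?n}" "card C = ?n - CARD('m)"
      "\<And>t. 0 < t \<Longrightarrow> t < ?n \<Longrightarrow> \<exists>e<CARD('N). t + e \<in> C"
    using exists_window_hitting_set[OF nm Nm _ count] by auto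
  have "C \<subseteq> {..<?n}"
    using C(1) by auto
  then have "card ({..<?n} - C) = CARD('m)"
    using C(2) nm by (simp add: card_Diff_subset finite_subset[of C])
  \<comment> \<open>\<open>\<gamma>\<close> lists the exponents of the columns of \<open>A1\<close>,
    \<open>\<phi>\<close> numbers its rows, and \<open>\<epsilon>\<close> numbers the columns of
    \<open>X1\<close> by the offsets in a window.\<close>
  then obtain \<gamma> :: "'m \<Rightarrow> nat" where \<gamma>: "bij_betw \<gamma> UNIV ({..<?n} - C)"
    by (rule exists_bij_betw_UNIV)
  obtain \<phi> :: "'n \<Rightarrow> nat" where \<phi>: "bij_betw \<phi> UNIV {..<?n}"
    by (rule exists_bij_betw_UNIV[of "{..<?n}"]) simp
  obtain \<epsilon> :: "'N \<Rightarrow> nat" where \<epsilon>: "bij_betw \<epsilon> UNIV {..<CARD('N)}"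
    by (rule exists_bij_betw_UNIV[of "{..<CARD('N)}"]) simp
  have \<gamma>_lt: "\<gamma> p < ?n" and \<gamma>_C: "\<gamma> p \<notin> C" for p
    using \<gamma> by (auto simp: bij_betw_def)
  have \<gamma>_inj: "\<gamma> p = \<gamma> p' \<longleftrightarrow> p = p'" for p p'
    using \<gamma> by (auto simp: bij_betw_def inj_on_def)
  have \<epsilon>_lt_N: "\<epsilon> q < CARD('N)" for q
    using bij_betwE[OF \<epsilon>] by simp
  have \<epsilon>_lt: "\<epsilon> q < ?n" for q
    using \<epsilon>_lt_N[of q] nm Nm by linarith
  have orth: "(\<Sum>i\<in>UNIV. w ^ (\<phi> i * a) / w ^ (\<phi> i * b)) = (if a = b then of_nat ?n else 0)"
    if "a < ?n" "b < ?n" for a b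
    using root_of_unity_orthogonality[OF w that]
    by (subst sum.reindex_bij_betw[OF \<phi>, of "\<lambda>i. w ^ (i * a) / w ^ (i * b)"]) simp
  define A1 :: "complex ^ 'm ^ 'n" where "A1 = (\<chi> i p. w ^ (\<phi> i * \<gamma> p))"
  define X1 :: "complex ^ 'N ^ 'm" where "X1 = (\<chi> p q. if \<gamma> p = \<epsilon> q then 1 else 0)"
  have A1X1: "(A1 ** X1) $ i $ q = w ^ (\<phi> i * \<epsilon> q)" for i q
  proof -
    have "\<epsilon> q \<in> {..<?n} - C"
      using C(1) \<epsilon>_lt[of q] \<epsilon>_lt_N[of q] by auto
    then obtain p where p: "\<epsilon> q = \<gamma> p"
      using \<gamma> by (auto simp: bij_betw_def)
    show ?thesis
      by (simp add: A1_def X1_def matrix_matrix_mult_def p \<gamma>_inj if_distrib[of "\<lambda>x. _ * x"] cong: if_cong)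
  qed
  have "rigid A1 X1"
    unfolding rigid_def
  proof (intro allI impI)
    fix h :: "complex ^ 'n" and X :: "complex ^ 'N ^ 'm"
    assume "\<forall>i q. (A1 ** X) $ i $ q = h $ i * (A1 ** X1) $ i $ q"
    then have eq: "(\<Sum>p\<in>UNIV. w ^ (\<phi> i * \<gamma> p) * X $ p $ q) = h $ i * w ^ (\<phi> i * \<epsilon> q)" for i q
      by (simp add: A1X1) (simp add: A1_def matrix_matrix_mult_def)
    \<comment> \<open>Pairing with the character of exponent \<open>b\<close> isolates the entry of
      \<open>X\<close> at the column with that exponent, and gives 0 if there is no such
      column.\<close>
    have test: "(\<Sum>i\<in>UNIV. h $ i * w ^ (\<phi> i * \<epsilon> q) / w ^ (\<phi> i * b)) =
        (\<Sum>p\<in>UNIV. X $ p $ q * (if \<gamma> p = b then of_nat ?n else 0))" if "b < ?n" for b q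
    proof -
      have "(\<Sum>i\<in>UNIV. h $ i * w ^ (\<phi> i * \<epsilon> q) / w ^ (\<phi> i * b)) =
          (\<Sum>i\<in>UNIV. \<Sum>p\<in>UNIV. X $ p $ q * (w ^ (\<phi> i * \<gamma> p) / w ^ (\<phi> i * b)))"
        unfolding eq[symmetric] by (simp add: sum_divide_distrib mult.commute)
      also have "\<dots> = (\<Sum>p\<in>UNIV. X $ p $ q * (\<Sum>i\<in>UNIV. w ^ (\<phi> i * \<gamma> p) / w ^ (\<phi> i * b)))"
        by (subst sum.swap) (simp add: sum_distrib_left)
      finally show ?thesis
        by (simp add: orth \<gamma>_lt that)
    qed
    define H where "H i = h $ inv \<phi> i" for i
    have H: "H (\<phi> i) = h $ i" for i
      using \<phi> by (simp add: H_def bij_betw_def)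
    define c where "c = (\<Sum>i<?n. H i) / of_nat ?n"
    have "(\<Sum>i<?n. H i / w ^ (i * t)) = 0" if t: "0 < t" "t < ?n" for t
    proof -
      obtain e where e: "e < CARD('N)" "t + e \<in> C"
        using C(3)[OF t] by blast
      then obtain q where q: "\<epsilon> q = e"
        using \<epsilon> by (metis bij_betw_imp_surj_on imageE lessThan_iff)
      have "(\<Sum>i<?n. H i / w ^ (i * t)) = (\<Sum>i\<in>UNIV. h $ i / w ^ (\<phi> i * t))"
        by (simp add: H flip: sum.reindex_bij_betw[OF \<phi>])
      \<comment> \<open>Multiplying and dividing by the character of exponent \<open>e\<close>
        shifts the frequency from \<open>t\<close> to \<open>t + e\<close>, which no column of
        \<open>A1\<close> has.\<close>
      also have "\<dots> = (\<Sum>i\<in>UNIV. h $ i * w ^ (\<phi> i * \<epsilon> q) / w ^ (\<phi> i * (t + e)))"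
        by (simp add: q distrib_left power_add)
      also have "\<dots> = (\<Sum>p\<in>UNIV. X $ p $ q * (if \<gamma> p = t + e then of_nat ?n else 0))"
        using e C(1) by (intro test) auto
      also have "\<dots> = 0"
        using \<gamma>_C e(2) by (intro sum.neutral ballI) (metis mult_zero_right)
      finally show ?thesis .
    qed
    then have Hc: "H j = c" if "j < ?n" for j
      unfolding c_def using that by (intro constant_if_Fourier_coefficients_zero[OF w])
    have h: "h $ i = c" for i
      using Hc[of "\<phi> i"] \<phi> by (auto simp: H bij_betw_def)
    \<comment> \<open>Once \<open>h\<close> is constant, testing against the character of column
      \<open>p\<close> itself reads off \<open>X $ p $ q\<close>.\<close>
    have "X $ p $ q = c * X1 $ p $ q" for p q
    proof -
      have "X $ p $ q * of_nat ?n = (\<Sum>p'\<in>UNIV. X $ p' $ q * (if \<gamma> p' = \<gamma> p then of_nat ?n else 0))"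
        by (simp add: \<gamma>_inj if_distrib[of "\<lambda>x. _ * x"] cong: if_cong)
      also have "\<dots> = (\<Sum>i\<in>UNIV. c * (w ^ (\<phi> i * \<epsilon> q) / w ^ (\<phi> i * \<gamma> p)))"
        by (simp add: h flip: test[OF \<gamma>_lt])
      also have "\<dots> = c * X1 $ p $ q * of_nat ?n"
        unfolding sum_distrib_left[symmetric] orth[OF \<epsilon>_lt \<gamma>_lt] by (auto simp: X1_def)
      finally show ?thesis
        by simp
    qed
    with h show "\<exists>c. (\<forall>i. h $ i = c) \<and> (\<forall>p q. X $ p $ q = c * X1 $ p $ q)"
      by blast
  qed
  then show ?thesis
    by blast
qed

theorem theorem1:
  fixes dummy_n :: "'n::finite itself" and dummy_m :: "'m::finite itself"
    and dummy_N :: "'N::finite itself"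
  assumes "CARD('n) > CARD('m)"
    and "real (CARD('n) - 1) / real (CARD('n) - CARD('m)) \<le> real CARD('N)"
    and "CARD('N) \<le> CARD('m)"
  shows "AE (l0, X0, A) in (lebesgue :: ((complex ^ 'n) \<times> (complex ^ 'N ^ 'm) \<times> (complex ^ 'm ^ 'n)) measure).
           \<forall>(l :: complex ^ 'n) (X :: complex ^ 'N ^ 'm).
             diag_mat l ** A ** X = diag_mat l0 ** A ** X0 \<longrightarrow>
             (\<exists>\<sigma>::complex. \<sigma> \<noteq> 0 \<and> l = \<sigma> *s l0 \<and> X = (\<chi> i j. X0 $ i $ j / \<sigma>))"
proof -
  have "real (CARD('n) - 1) \<le> real (CARD('N) * (CARD('n) - CARD('m)))"
    using assms(1,2) by (simp add: pos_divide_le_eq)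
  then have "CARD('n) - 1 \<le> CARD('N) * (CARD('n) - CARD('m))"
    by (simp only: of_nat_le_iff)
  then obtain A1 :: "complex ^ 'm ^ 'n" and X1 :: "complex ^ 'N ^ 'm" where "rigid A1 X1"
    using exists_rigid[where 'n = 'n and 'm = 'm and 'N = 'N] assms by blast
  then have rigid: "AE (l0 :: complex ^ 'n, X0 :: complex ^ 'N ^ 'm, A :: complex ^ 'm ^ 'n) in lebesgue.
      rigid A X0"
    by (rule AE_rigid)
  \<comment> \<open>Each coordinate of the gain vector is a polynomial that is nonzero at the
    all-ones vector.\<close>
  have "AE x in (lebesgue :: ((complex ^ 'n) \<times> (complex ^ 'N ^ 'm) \<times> (complex ^ 'm ^ 'n)) measure).
      fst x $ i \<noteq> 0" for i
    by (rule AE_nonzero_complex_polynomial_function[where a = "(\<chi> i. 1, 0, 0)"])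
       (auto intro!: polynomial_function_bounded_linear bounded_linear_compose[OF bounded_linear_vec_nth]
         bounded_linear_fst)
  then have l0: "AE x in (lebesgue :: ((complex ^ 'n) \<times> (complex ^ 'N ^ 'm) \<times> (complex ^ 'm ^ 'n)) measure).
      \<forall>i. fst x $ i \<noteq> 0"
    by (simp add: AE_all_countable)
  \<comment> \<open>Types are nonempty, so \<open>CARD('m)\<close> is at least 1.\<close>
  have "1 < CARD('n)"
    using assms(1) zero_less_card_finite[where 'a = 'm] by linarith
  show ?thesis
    using rigid l0
  proof eventually_elim
    case (elim x)
    obtain l0 X0 A where x: "x = (l0, X0, A)"
      by (cases x)
    with elim show ?case
      using rigid_imp_identifiable[OF _ _ \<open>1 < CARD('n)\<close>, of A X0 l0] by simp
  qed
qed

end
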